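(* Let $\mathcal H$ be a real Hilbert space and let $F:\mathcal H\to\mathcal H$ be a monotone, $L$-Lipschitz operator with $L>0$ and a solution $x^*\in\mathcal H$ such that $F(x^* )=0$. Let $x_0\in\mathcal H$ and let $R:=\|x_0-x^*\|$. Let $\eta=\frac{1}{8L}$ and $\delta_k=\frac{8}{k+64}$ for $k\ge0$, let $G_k(x):=\eta F(x)+\delta_k(x-x_0)$, and consider the regularized past-extragradient method with main iterate initialized at $x_0$ and $\tilde x_{-1}=x_0$, $$\tilde x_k=x_k-G_k(\tilde x_{k-1}),\qquad x_{k+1}=x_k-G_k(\tilde x_k),\qquad k\ge0.$$ Then, for all $k\ge1$, $$\|F(x_k)\|\le\frac{256LR}{k+63}.$$
   Context: An operator $F:\mathcal H\to\mathcal H$ on a real Hilbert space is monotone if $\langle F(x)-F(y),x-y\rangle\ge0$ for all $x,y\in\mathcal H$, and $L$-Lipschitz if $\|F(x)-F(y)\|\le L\|x-y\|$ for all $x,y\in\mathcal H$. *)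

theory Defs
  imports "HOL-Analysis.Analysis"
begin

definition monotone_operator :: "('a::real_inner \<Rightarrow> 'a) \<Rightarrow> bool" where
  "monotone_operator F \<longleftrightarrow> (\<forall>x y. inner (F x - F y) (x - y) \<ge> 0)"

definition regularized_operator ::
    "real \<Rightarrow> (nat \<Rightarrow> real) \<Rightarrow> 'a::real_inner \<Rightarrow> ('a \<Rightarrow> 'a) \<Rightarrow> nat \<Rightarrow> 'a \<Rightarrow> 'a" where
  "regularized_operator \<eta> \<delta> x0 F k x = \<eta> *\<^sub>R F x + \<delta> k *\<^sub>R (x - x0)"

(* The extrapolated sequence, which starts at index -1, is stored shifted by one:
   y k stands for the point usually written x~_{k-1}, so y 0 is x~_{-1} and y (Suc k) is x~_k. *)
definition past_extragradient ::
    "(nat \<Rightarrow> 'a::real_inner \<Rightarrow> 'a) \<Rightarrow> 'a \<Rightarrow> (nat \<Rightarrow> 'a) \<Rightarrow> (nat \<Rightarrow> 'a) \<Rightarrow> bool" where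
  "past_extragradient G x0 x y \<longleftrightarrow>
     x 0 = x0 \<and> y 0 = x0 \<and>
     (\<forall>k. y (Suc k) = x k - G k (y k)) \<and>
     (\<forall>k. x (Suc k) = x k - G k (y (Suc k)))"

end

(* The residual of the regularized operator is tracked through
   Q_k = norm (G_k x_k, G_k x_k - G_k y_k), a norm on the product space.
   For a fixed operator G_k, which is 1/4-Lipschitz and delta_k-strongly monotone, one step of the
   method contracts Q by the factor 1 - 3/4 delta_k.  Replacing G_k by G_(k+1) costs at most
   (delta_k - delta_(k+1)) (norm (x_(k+1) - x_0) + norm (x_(k+1) - y_(k+1))) = O(delta_k^2 R), which the
   contraction absorbs, so Q_k <= delta_k R for all k.  Finally, the regularized equation expresses
   the scaled F x_k as a Yosida approximation, so its norm is at most delta_k R + Q_k. *)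
theory Submission
  imports Defs
begin

text \<open>Here \<open>g0\<close>, \<open>h'\<close>, \<open>h\<close>, \<open>g1\<close> stand for
  \<open>G k\<close> at \<open>x k\<close>, \<open>y k\<close>, \<open>y (Suc k)\<close>,
  \<open>x (Suc k)\<close>, so \<open>h\<close> is the main step and \<open>h' - h\<close> is
  \<open>x (Suc k) - y (Suc k)\<close>. Both hypotheses thus involve only the four values of
  \<open>G k\<close>.\<close>

lemma past_extragradient_residual_contraction:
  fixes g0 g1 h h' :: "'a::real_inner"
  assumes mono: "\<mu> * (norm h)\<^sup>2 \<le> inner (g0 - g1) h"
    and lip: "norm (g1 - h) \<le> 1/4 * norm (h - h')"
    and \<mu>: "0 \<le> \<mu>" "\<mu> \<le> 1/8"
  shows "norm (g1, g1 - h) \<le> (1 - 3/4 * \<mu>) * norm (g0, g0 - h')"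
proof -
  define a b c where "a = (norm g0)\<^sup>2" and "b = (norm (g0 - h))\<^sup>2" and "c = (norm (g0 - h'))\<^sup>2"
  define p q r where "p = (norm g1)\<^sup>2" and "q = (norm (g1 - h))\<^sup>2" and "r = (norm h)\<^sup>2"
  note defs = a_def b_def c_def p_def q_def r_def
  have nonneg: "0 \<le> a" "0 \<le> b" "0 \<le> c" "0 \<le> q" "0 \<le> r"
    unfolding defs by simp_all
  \<comment> \<open>The identity behind this is
    \<open>2 * inner (g0 - g1) h = a - b - p + q\<close>.\<close>
  have descent: "p + 2 * \<mu> * r \<le> a + q - b"
    using mono unfolding defs power2_norm_eq_inner
    by (simp add: inner_diff_left inner_diff_right inner_commute)
  have "16 * q \<le> (norm (h - h'))\<^sup>2"
    using power_mono[OF lip, of 2] unfolding defs by (simp add: power_mult_distrib power2_eq_square)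
  also have "\<dots> \<le> 2 * b + 2 * c"
  proof -
    have "0 \<le> (norm ((g0 - h) + (g0 - h')))\<^sup>2" by simp
    then show ?thesis unfolding defs power2_norm_eq_inner
      by (simp add: inner_diff_left inner_diff_right inner_add_left inner_add_right inner_commute)
  qed
  finally have q_le: "8 * q \<le> b + c" by simp
  \<comment> \<open>Young's inequality, with the weight chosen so that the b-term is absorbed when \<mu> is 1/8.\<close>
  have "a \<le> 4/3 * r + 4 * b"
  proof -
    have "0 \<le> (norm (h - 3 *\<^sub>R (g0 - h)))\<^sup>2" by simp
    then show ?thesis unfolding defs power2_norm_eq_inner
      by (simp add: inner_diff_left inner_diff_right inner_commute)
  qed
  then have "\<mu> * (3/2 * a) \<le> \<mu> * (2 * r + 6 * b)"
    using \<mu> by (intro mult_left_mono) auto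
  then have young: "3/2 * (\<mu> * a) \<le> 2 * \<mu> * r + 6 * (\<mu> * b)"
    by (simp add: algebra_simps)
  have "\<mu> * b \<le> 1/8 * b" "\<mu> * c \<le> 1/8 * c"
    using \<mu> nonneg by (intro mult_right_mono; simp)+
  \<comment> \<open>Adding \<open>q\<close> to \<open>descent\<close> leaves \<open>2 * q\<close>,
    which costs at most (b + c)/4. The remaining -3/4 b absorbs \<open>6 * (\<mu> * b)\<close>, and
    c/4 + 3/2 \<mu> c stays below c.\<close>
  then have "p + q \<le> (a + c) - 3/2 * (\<mu> * a) - 3/2 * (\<mu> * c)"
    using descent q_le young nonneg by linarith
  also have "\<dots> = (1 - 3/2 * \<mu>) * (a + c)"
    by (simp add: algebra_simps)
  also have "\<dots> \<le> (1 - 3/4 * \<mu>)\<^sup>2 * (a + c)"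
    using nonneg by (intro mult_right_mono) (auto simp: power2_eq_square algebra_simps)
  finally have "(norm (g1, g1 - h))\<^sup>2 \<le> ((1 - 3/4 * \<mu>) * norm (g0, g0 - h'))\<^sup>2"
    unfolding defs by (simp add: norm_Pair power_mult_distrib)
  then show ?thesis
    by (rule power2_le_imp_le) (use \<mu> in \<open>intro mult_nonneg_nonneg norm_ge_zero; simp\<close>)
qed

text \<open>Moving the centre of the regularization from \<open>x0\<close> to the zero
  \<open>xs\<close> changes the residual by \<open>d *\<^sub>R (x0 - xs)\<close>. Around
  \<open>xs\<close>, monotonicity prevents the operator and the regularizer from cancelling.\<close>

lemma regularized_operator_bounds:
  fixes A :: "'a::real_inner \<Rightarrow> 'a"
  assumes mono: "monotone_operator A" and zero: "A xs = 0" and d: "0 < d"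
  shows "norm (A x) \<le> d * norm (x0 - xs) + norm (A x + d *\<^sub>R (x - x0))" (is ?operator)
    and "d * norm (x - x0) \<le> 2 * d * norm (x0 - xs) + norm (A x + d *\<^sub>R (x - x0))" (is ?distance)
proof -
  let ?g = "A x + d *\<^sub>R (x - x0)"
  let ?v = "?g + d *\<^sub>R (x0 - xs)"
  have v: "?v = A x + d *\<^sub>R (x - xs)" by (simp add: algebra_simps)
  have "norm ?v \<le> norm ?g + norm (d *\<^sub>R (x0 - xs))" by (rule norm_triangle_ineq)
  then have v_le: "norm ?v \<le> d * norm (x0 - xs) + norm ?g" using d by simp
  have "0 \<le> inner (A x) (x - xs)"
    using mono zero unfolding monotone_operator_def by (metis diff_zero)
  then have "0 \<le> d * inner (A x) (x - xs)" using d by simp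
  \<comment> \<open>The two summands of ?v form a nonnegative inner product, so each is dominated by ?v.\<close>
  then have "(norm (A x))\<^sup>2 + (norm (d *\<^sub>R (x - xs)))\<^sup>2 \<le> (norm ?v)\<^sup>2"
    unfolding v power2_norm_eq_inner
    by (simp add: inner_add_left inner_add_right inner_commute)
  then have "(norm (A x))\<^sup>2 \<le> (norm ?v)\<^sup>2" "(norm (d *\<^sub>R (x - xs)))\<^sup>2 \<le> (norm ?v)\<^sup>2"
    using zero_le_power2[of "norm (A x)"] zero_le_power2[of "norm (d *\<^sub>R (x - xs))"] by linarith+
  then have *: "norm (A x) \<le> norm ?v" "norm (d *\<^sub>R (x - xs)) \<le> norm ?v"
    by - (erule power2_le_imp_le, rule norm_ge_zero)+
  show ?operator using * v_le by linarith
  have "d * norm (x - x0) \<le> d * (norm (x - xs) + norm (x0 - xs))"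
    using d norm_triangle_ineq4[of "x - xs" "x0 - xs"] by simp
  also have "\<dots> = norm (d *\<^sub>R (x - xs)) + d * norm (x0 - xs)"
    using d by (simp add: distrib_left)
  finally show ?distance using * v_le by linarith
qed

lemma past_extragradient_residual_bound:
  fixes A :: "'a::real_inner \<Rightarrow> 'a" and \<delta> :: "nat \<Rightarrow> real"
  assumes mono: "monotone_operator A"
    and lip: "\<And>u v. norm (A u - A v) \<le> 1/8 * norm (u - v)"
    and zero: "A xs = 0"
    and \<delta>: "\<And>k. \<delta> k = 8 / (real k + 64)"
    and G: "\<And>k u. G k u = A u + \<delta> k *\<^sub>R (u - x0)"
    and peg: "past_extragradient G x0 x y"
  shows "norm (G k (x k), G k (x k) - G k (y k)) \<le> \<delta> k * norm (x0 - xs)"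
proof (induction k)
  case 0
  have "x 0 = x0" "y 0 = x0" using peg by (auto simp: past_extragradient_def)
  \<comment> \<open>At the start the regularizer and the second component vanish, leaving
    \<open>norm (A x0)\<close>. The offset 64 makes \<open>\<delta> 0\<close> equal to 1/8, the
    Lipschitz constant of \<open>A\<close>.\<close>
  then show ?case using lip[of x0 xs] zero by (simp add: G \<delta>)
next
  case (Suc k)
  define R where "R = norm (x0 - xs)"
  define Q where "Q = norm (G k (x k), G k (x k) - G k (y k))"
  define g0 h' h g1 where "g0 = G k (x k)" and "h' = G k (y k)"
    and "h = G k (y (Suc k))" and "g1 = G k (x (Suc k))"
  note G_defs = g0_def h'_def h_def g1_def
  have ySuc: "y (Suc k) = x k - h'" and xSuc: "x (Suc k) = x k - h"
    using peg by (auto simp: past_extragradient_def G_defs)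
  have diff_xy: "x (Suc k) - y (Suc k) = h' - h" by (simp add: xSuc ySuc)
  have \<delta>k: "0 < \<delta> k" "\<delta> k \<le> 1/8" "0 < \<delta> (Suc k)" "\<delta> (Suc k) \<le> \<delta> k"
    by (auto simp: \<delta> field_simps)
  have R0: "0 \<le> R" by (simp add: R_def)
  have QR: "Q \<le> \<delta> k * R" using Suc by (simp add: Q_def R_def)
  also have "\<dots> \<le> 1/8 * R" using \<delta>k R0 by (intro mult_right_mono) auto
  finally have Q_small: "Q \<le> 1/8 * R" .
  have Glip: "norm (G k u - G k v) \<le> 1/4 * norm (u - v)" for u v
  proof -
    have "G k u - G k v = (A u - A v) + \<delta> k *\<^sub>R (u - v)" by (simp add: G algebra_simps)
    then have "norm (G k u - G k v) \<le> norm (A u - A v) + norm (\<delta> k *\<^sub>R (u - v))"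
      by (simp only: norm_triangle_ineq)
    moreover have "norm (\<delta> k *\<^sub>R (u - v)) \<le> 1/8 * norm (u - v)"
      using \<delta>k mult_right_mono[OF \<delta>k(2) norm_ge_zero[of "u - v"]] by simp
    ultimately show ?thesis using lip[of u v] by linarith
  qed
  have "\<delta> k * (norm h)\<^sup>2 \<le> inner (g0 - g1) h"
  proof -
    have "g0 - g1 = (A (x k) - A (x (Suc k))) + \<delta> k *\<^sub>R h"
      by (simp add: G_defs G xSuc algebra_simps)
    moreover have "0 \<le> inner (A (x k) - A (x (Suc k))) h"
      using mono xSuc by (metis monotone_operator_def diff_diff_eq2 add_diff_cancel_left')
    ultimately show ?thesis by (simp add: inner_add_left power2_norm_eq_inner)
  qed
  moreover have "norm (g1 - h) \<le> 1/4 * norm (h - h')"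
    using Glip[of "x (Suc k)" "y (Suc k)"]
    by (simp add: g1_def h_def diff_xy norm_minus_commute)
  ultimately have contr: "norm (g1, g1 - h) \<le> (1 - 3/4 * \<delta> k) * Q"
    using \<delta>k past_extragradient_residual_contraction[of "\<delta> k" h g0 g1 h']
    by (simp add: Q_def g0_def h'_def)
  also have "\<dots> \<le> 1 * Q" using \<delta>k by (intro mult_right_mono) (auto simp: Q_def)
  also have "\<dots> \<le> \<delta> k * R" using QR by simp
  finally have "norm g1 \<le> \<delta> k * R"
    using norm_fst_le[of g1 "g1 - h"] by linarith
  moreover have "\<delta> k * norm (x (Suc k) - x0) \<le> 2 * \<delta> k * R + norm g1"
    using regularized_operator_bounds(2)[OF mono zero \<delta>k(1), of "x (Suc k)" x0]
    by (simp add: R_def g1_def G)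
  \<comment> \<open>The residual is itself of order \<open>\<delta> k * R\<close>, so
    \<open>\<delta> k\<close> cancels and the drift from \<open>x0\<close> is bounded uniformly in
    \<open>k\<close>.\<close>
  ultimately have "\<delta> k * norm (x (Suc k) - x0) \<le> \<delta> k * (3 * R)" by linarith
  then have dist0: "norm (x (Suc k) - x0) \<le> 3 * R" using \<delta>k by simp
  \<comment> \<open>Since \<open>norm h'\<close> is at most 2 Q, the displacement is at most Q/2 +
    Q, hence at most 3/16 R.\<close>
  have distxy: "norm (x (Suc k) - y (Suc k)) \<le> R"
  proof -
    have "norm g0 \<le> Q" "norm (g0 - h') \<le> Q"
      using norm_fst_le[of g0 "g0 - h'"] norm_snd_le[of "g0 - h'" g0]
      by (simp_all add: Q_def g0_def h'_def)
    moreover have "norm (g0 - h) \<le> 1/4 * norm h'"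
    proof -
      have "x k - y (Suc k) = h'" by (simp add: ySuc)
      then show ?thesis using Glip[of "x k" "y (Suc k)"] by (simp add: g0_def h_def)
    qed
    moreover have "norm h' \<le> norm g0 + norm (g0 - h')"
      using norm_triangle_ineq4[of g0 "g0 - h'"] by simp
    moreover have "norm (h' - h) \<le> norm (g0 - h) + norm (g0 - h')"
      using norm_triangle_ineq4[of "g0 - h" "g0 - h'"] by simp
    ultimately show ?thesis unfolding diff_xy using Q_small R0 by linarith
  qed
  define \<epsilon> where "\<epsilon> = \<delta> k - \<delta> (Suc k)"
  define w where "w = (x (Suc k) - x0, x (Suc k) - y (Suc k))"
  have "norm w \<le> norm (x (Suc k) - x0) + norm (x (Suc k) - y (Suc k))"
    unfolding w_def norm_Pair by (rule sqrt_sum_squares_le_sum) simp_all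
  then have w: "norm w \<le> 4 * R" using dist0 distxy by linarith
  \<comment> \<open>Passing from \<open>G k\<close> to \<open>G (Suc k)\<close> subtracts
    \<open>\<epsilon> *\<^sub>R (u - x0)\<close> at each point \<open>u\<close>; in the second
    component \<open>x0\<close> cancels.\<close>
  have "(G (Suc k) (x (Suc k)), G (Suc k) (x (Suc k)) - G (Suc k) (y (Suc k)))
      = (g1, g1 - h) - \<epsilon> *\<^sub>R w"
    by (simp add: G G_defs w_def \<epsilon>_def algebra_simps)
  then have "norm (G (Suc k) (x (Suc k)), G (Suc k) (x (Suc k)) - G (Suc k) (y (Suc k)))
      \<le> norm (g1, g1 - h) + norm (\<epsilon> *\<^sub>R w)"
    by (simp only: norm_triangle_ineq4)
  also have "\<dots> \<le> (1 - 3/4 * \<delta> k) * (\<delta> k * R) + \<epsilon> * (4 * R)"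
  proof (rule add_mono)
    show "norm (g1, g1 - h) \<le> (1 - 3/4 * \<delta> k) * (\<delta> k * R)"
      using contr by (rule order_trans) (use QR \<delta>k in \<open>auto intro: mult_left_mono\<close>)
    show "norm (\<epsilon> *\<^sub>R w) \<le> \<epsilon> * (4 * R)"
      using w \<delta>k by (auto simp: \<epsilon>_def intro: mult_left_mono)
  qed
  also have "\<dots> \<le> \<delta> (Suc k) * R"
  proof -
    \<comment> \<open>The drift costs 4 \<epsilon> and the smaller target \<epsilon> more. The
      numerator 8 in \<open>\<delta>\<close> makes this total at most 5/8 of the squared
      \<open>\<delta> k\<close>, within the 3/4 gained by contraction.\<close>
    have "8 * \<epsilon> = \<delta> k * \<delta> (Suc k)" by (simp add: \<epsilon>_def \<delta> divide_simps)
    also have "\<dots> \<le> \<delta> k * \<delta> k" using \<delta>k by simp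
    finally have "5 * \<epsilon> \<le> 3/4 * (\<delta> k * \<delta> k)"
      using mult_pos_pos[OF \<delta>k(1) \<delta>k(1)] by linarith
    then have "(1 - 3/4 * \<delta> k) * \<delta> k + 4 * \<epsilon> \<le> \<delta> (Suc k)"
      unfolding \<epsilon>_def by (simp add: algebra_simps)
    from mult_right_mono[OF this R0] show ?thesis by (simp add: algebra_simps)
  qed
  finally show ?case by (simp add: R_def)
qed

theorem theorem3:
  fixes F :: "'a::{real_inner, complete_space} \<Rightarrow> 'a"
    and L R \<eta> :: real
    and \<delta> :: "nat \<Rightarrow> real"
    and x0 xstar :: 'a
    and x y :: "nat \<Rightarrow> 'a"
  assumes "L > 0"
    and "monotone_operator F"
    and "L-lipschitz_on UNIV F"
    and "F xstar = 0"
    and "R = norm (x0 - xstar)"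
    and "\<eta> = 1 / (8 * L)"
    and "\<And>k. \<delta> k = 8 / (real k + 64)"
    and "past_extragradient (regularized_operator \<eta> \<delta> x0 F) x0 x y"
  shows "\<forall>k\<ge>1. norm (F (x k)) \<le> 256 * L * R / (real k + 63)"
proof (intro allI impI)
  fix k :: nat
  define A where "A = (\<lambda>u. \<eta> *\<^sub>R F u)"
  define G where "G = regularized_operator \<eta> \<delta> x0 F"
  have \<eta>: "0 < \<eta>" "\<eta> * L = 1/8" using assms(1,6) by simp_all
  have mono: "monotone_operator A"
    using assms(2) \<eta> by (simp add: monotone_operator_def A_def flip: scaleR_diff_right)
  have lip: "norm (A u - A v) \<le> 1/8 * norm (u - v)" for u v
  proof -
    have "norm (F u - F v) \<le> L * norm (u - v)"
      using lipschitz_onD[OF assms(3), of u v] by (simp add: dist_norm)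
    then have "\<eta> * norm (F u - F v) \<le> \<eta> * (L * norm (u - v))" using \<eta> by simp
    also have "\<dots> = 1/8 * norm (u - v)" using \<eta> by (simp flip: mult.assoc)
    finally show ?thesis using \<eta> by (simp add: A_def flip: scaleR_diff_right)
  qed
  have zero: "A xstar = 0" using assms(4) by (simp add: A_def)
  have G: "G j u = A u + \<delta> j *\<^sub>R (u - x0)" for j u
    by (simp add: G_def A_def regularized_operator_def)
  have "norm (G k (x k)) \<le> \<delta> k * R"
    using past_extragradient_residual_bound[OF mono lip zero assms(7) G, of x y k]
      norm_fst_le[of "G k (x k)" "G k (x k) - G k (y k)"] assms(5,8) by (simp add: G_def)
  moreover have "norm (A (x k)) \<le> \<delta> k * R + norm (G k (x k))"
    using regularized_operator_bounds(1)[OF mono zero, of "\<delta> k" "x k" x0] assms(5,7)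
    by (simp add: G)
  ultimately have "\<eta> * norm (F (x k)) \<le> 2 * \<delta> k * R" using \<eta> by (simp add: A_def)
  \<comment> \<open>The constant is 2 * 8 * 8: two terms \<open>\<delta> k * R\<close>, the
    numerator of \<open>\<delta>\<close>, and the 8 in 1/\<eta>.\<close>
  then have "norm (F (x k)) \<le> 128 * L * R / (real k + 64)"
    using assms(1) by (simp add: assms(6,7) field_simps)
  also have "\<dots> \<le> 256 * L * R / (real k + 63)"
    using assms(1,5) by (intro frac_le) auto
  finally show "norm (F (x k)) \<le> 256 * L * R / (real k + 63)" .
qed

end
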